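(* Let $D\subset\mathbf{R}$ be an open interval, let $m\ge 2$ be an integer, and let $f:D\to\mathbf{R}$ be sufficiently differentiable (of class $C^{m+3}$) with a multiple zero $\alpha\in D$ of multiplicity $m$. Put $$\theta=\left(\frac{m-1}{m}\right)^{m-1}.$$ Then, for an initial approximation $x_0\in D$ of $\alpha$, the iterative method $$y_n=x_n-\frac{f(x_n)}{f'(x_n)},\qquad x_{n+1}=x_n-\frac{\theta f(x_n)}{\theta f(x_n)-f(y_n)}\,\frac{f(x_n)}{f'(x_n)},\qquad n=0,1,2,\ldots,$$ has order of convergence three at $\alpha$.
   Context: A zero $\alpha$ of $f$ has multiplicity $m$ if $f(\alpha)=f'(\alpha)=\cdots=f^{(m-1)}(\alpha)=0$ and $f^{(m)}(\alpha)\neq 0$. The method having order (of convergence) three at $\alpha$ is meant in the usual local sense of an error equation. Write $e_n=x_n-\alpha$. For every $x_n\ne\alpha$ sufficiently close to $\alpha$, the next iterate $x_{n+1}$ is well defined (that is, $f'(x_n)\neq 0$, $y_n\in D$ and $\theta f(x_n)-f(y_n)\ne 0$), and $$e_{n+1}=C\,e_n^3+O(e_n^4)\quad\text{as } e_n\to 0,$$ where $C$ is a constant depending only on $m$ and the derivatives of $f$ at $\alpha$ ($C$ is allowed to vanish for special $f$). The initial approximation $x_0$ is understood to be sufficiently close to $\alpha$, and the iteration is stopped if some $x_n=\alpha$. *)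

theory Defs
  imports "HOL-Analysis.Analysis" "HOL-Library.Landau_Symbols"
begin

text \<open>A function on an open set \<open>D\<close> is a total function of which only the values on \<open>D\<close> matter:
  since \<open>D\<close> is open, all iterated derivatives at points of \<open>D\<close> are determined by these values.\<close>

definition C_class_on :: "nat \<Rightarrow> real set \<Rightarrow> (real \<Rightarrow> real) \<Rightarrow> bool" where
  "C_class_on k D f \<longleftrightarrow>
     (\<forall>j<k. \<forall>x\<in>D. (deriv ^^ j) f field_differentiable at x) \<and>
     continuous_on D ((deriv ^^ k) f)"

definition zero_of_multiplicity :: "(real \<Rightarrow> real) \<Rightarrow> real \<Rightarrow> nat \<Rightarrow> bool" where
  "zero_of_multiplicity f \<alpha> m \<longleftrightarrow>
     (\<forall>j<m. (deriv ^^ j) f \<alpha> = 0) \<and> (deriv ^^ m) f \<alpha> \<noteq> 0"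

definition newton_point :: "(real \<Rightarrow> real) \<Rightarrow> real \<Rightarrow> real" where
  "newton_point f x = x - f x / deriv f x"

definition next_iterate :: "real \<Rightarrow> (real \<Rightarrow> real) \<Rightarrow> real \<Rightarrow> real" where
  "next_iterate \<theta> f x =
     x - \<theta> * f x / (\<theta> * f x - f (newton_point f x)) * (f x / deriv f x)"

definition next_iterate_defined :: "real set \<Rightarrow> real \<Rightarrow> (real \<Rightarrow> real) \<Rightarrow> real \<Rightarrow> bool" where
  "next_iterate_defined D \<theta> f x \<longleftrightarrow>
     deriv f x \<noteq> 0 \<and> newton_point f x \<in> D \<and> \<theta> * f x - f (newton_point f x) \<noteq> 0"

text \<open>The error equation \<open>e\<^sub>n\<^sub>+\<^sub>1 = C e\<^sub>n\<^sup>3 + O(e\<^sub>n\<^sup>4)\<close> as a statement about one step from an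
  arbitrary \<open>x\<^sub>n = x \<noteq> \<alpha>\<close> close to \<open>\<alpha>\<close>; the punctured filter \<open>at \<alpha> within D\<close> excludes \<open>x = \<alpha>\<close>.\<close>

definition order_three_at :: "real set \<Rightarrow> real \<Rightarrow> (real \<Rightarrow> real) \<Rightarrow> real \<Rightarrow> real \<Rightarrow> bool" where
  "order_three_at D \<theta> f \<alpha> C \<longleftrightarrow>
     (\<forall>\<^sub>F x in at \<alpha> within D. next_iterate_defined D \<theta> f x) \<and>
     (\<lambda>x. (next_iterate \<theta> f x - \<alpha>) - C * (x - \<alpha>) ^ 3) \<in> O[at \<alpha> within D](\<lambda>x. (x - \<alpha>) ^ 4)"

end

theory Submission
  imports Defs
begin

text \<open>
  Near the zero write \<open>e = x - \<alpha>\<close>, \<open>f x = c e\<^sup>m F(x)\<close>, \<open>f' x = c e\<^sup>m\<^sup>-\<^sup>1 G(x)\<close> with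
  \<open>F = 1 + A e + B e\<^sup>2 + O(e\<^sup>3)\<close> and \<open>G = m + (m + 1) A e + (m + 2) B e\<^sup>2 + O(e\<^sup>3)\<close>.
  With \<open>r = (m - 1) / m\<close> the Newton point is \<open>y = \<alpha> + r e w\<close>, where \<open>w = (1 - F / G) / r\<close> tends to 1;
  since \<open>r\<^sup>m = \<theta> r\<close>, the next error is \<open>e (1 - (F / T) (F / G))\<close> with \<open>T = F(x) - r F(y) w\<^sup>m\<close>.
  Both \<open>m F / G\<close> and \<open>m T / F\<close> start with \<open>1 - (A / m) e\<close>, so the linear terms
  cancel in the quotient, and the quadratic term gives the asymptotic constant
  \<open>A\<^sup>2 / (2 m) - (m - 1) B / m\<^sup>2\<close>.
\<close>

section \<open>Second-order expansions at a point with cubic error\<close>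

text \<open>The filter is punctured, so the value at \<alpha> does not enter. This admits quotients
  such as \<open>f x / (x - \<alpha>)^m\<close>, which take the default value of division by zero
  there. A cubic remainder is precise enough because the error of the method carries one more factor
  \<open>x - \<alpha>\<close>.\<close>

definition quad_expansion :: "real \<Rightarrow> (real \<Rightarrow> real) \<Rightarrow> real \<Rightarrow> real \<Rightarrow> real \<Rightarrow> bool" where
  "quad_expansion \<alpha> g a b c \<longleftrightarrow>
     (\<lambda>x. g x - (a + b * (x - \<alpha>) + c * (x - \<alpha>)^2)) \<in> O[at \<alpha>](\<lambda>x. (x - \<alpha>)^3)"

lemma tendsto_imp_bigo_1:
  fixes g :: "real \<Rightarrow> real"
  assumes "(g \<longlongrightarrow> l) F"
  shows "g \<in> O[F](\<lambda>_. 1)"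
  using assms by (intro bigoI_tendsto[of _ _ l]) auto

lemma quad_expansion_poly: "quad_expansion \<alpha> (\<lambda>x. a + b * (x - \<alpha>) + c * (x - \<alpha>)^2) a b c"
  by (simp add: quad_expansion_def)

lemma quad_expansion_const: "quad_expansion \<alpha> (\<lambda>x. a) a 0 0"
  by (simp add: quad_expansion_def)

lemma quad_expansion_tendsto:
  assumes "quad_expansion \<alpha> g a b c"
  shows "(g \<longlongrightarrow> a) (at \<alpha>)"
proof -
  have "((\<lambda>x. (x - \<alpha>)^3) \<longlongrightarrow> 0) (at \<alpha>)"
    by (rule tendsto_eq_intros refl | simp)+
  then have "(\<lambda>x. (x - \<alpha>)^3) \<in> o[at \<alpha>](\<lambda>_. 1)"
    by (intro smalloI_tendsto) (simp_all)
  with assms have "(\<lambda>x. g x - (a + b * (x - \<alpha>) + c * (x - \<alpha>)^2)) \<in> o[at \<alpha>](\<lambda>_. 1)"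
    unfolding quad_expansion_def by (rule landau_o.big_small_trans)
  then have 1: "((\<lambda>x. g x - (a + b * (x - \<alpha>) + c * (x - \<alpha>)^2)) \<longlongrightarrow> 0) (at \<alpha>)"
    by (auto dest: smalloD_tendsto)
  have 2: "((\<lambda>x. a + b * (x - \<alpha>) + c * (x - \<alpha>)^2) \<longlongrightarrow> a) (at \<alpha>)"
    by (rule tendsto_eq_intros refl | simp)+
  show ?thesis using tendsto_add[OF 1 2] by simp
qed

lemma quad_expansion_bigo_1: "quad_expansion \<alpha> g a b c \<Longrightarrow> g \<in> O[at \<alpha>](\<lambda>_. 1)"
  by (rule tendsto_imp_bigo_1[OF quad_expansion_tendsto])

lemma quad_expansion_eventually_nonzero:
  assumes "quad_expansion \<alpha> g a b c" "a \<noteq> 0"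
  shows "\<forall>\<^sub>F x in at \<alpha>. g x \<noteq> 0"
  by (rule tendsto_imp_eventually_ne[OF quad_expansion_tendsto[OF assms(1)] assms(2)])

lemma quad_expansion_add:
  assumes "quad_expansion \<alpha> g a b c" "quad_expansion \<alpha> h a' b' c'"
  shows "quad_expansion \<alpha> (\<lambda>x. g x + h x) (a + a') (b + b') (c + c')"
  using sum_in_bigo(1)[OF assms[unfolded quad_expansion_def]]
  by (simp add: quad_expansion_def algebra_simps)

text \<open>With \<open>P\<close> and \<open>Q\<close> the quadratic parts, the error splits into
  \<open>(g - P) h\<close>, \<open>P (h - Q)\<close> and the terms of \<open>P Q\<close> of degree
  at least three. Each is a bounded function times a cubically small one.\<close>

lemma quad_expansion_mult:
  assumes g: "quad_expansion \<alpha> g a b c" and h: "quad_expansion \<alpha> h a' b' c'"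
  shows "quad_expansion \<alpha> (\<lambda>x. g x * h x) (a * a') (a * b' + b * a') (a * c' + b * b' + c * a')"
proof -
  define P where "P = (\<lambda>x. a + b * (x - \<alpha>) + c * (x - \<alpha>)^2)"
  define Q where "Q = (\<lambda>x. a' + b' * (x - \<alpha>) + c' * (x - \<alpha>)^2)"
  have 1: "(\<lambda>x. (g x - P x) * h x) \<in> O[at \<alpha>](\<lambda>x. (x - \<alpha>)^3)"
    using landau_o.big.mult[OF g[unfolded quad_expansion_def] quad_expansion_bigo_1[OF h]]
    by (simp add: P_def)
  have "P \<in> O[at \<alpha>](\<lambda>_. 1)"
    unfolding P_def by (rule quad_expansion_bigo_1[OF quad_expansion_poly])
  from landau_o.big.mult[OF this h[unfolded quad_expansion_def]]
  have 2: "(\<lambda>x. P x * (h x - Q x)) \<in> O[at \<alpha>](\<lambda>x. (x - \<alpha>)^3)"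
    by (simp add: Q_def)
  \<comment> \<open>The degree 3 and 4 terms of \<open>P Q\<close>, with the cube factored out,
    leave this bounded cofactor.\<close>
  have "(\<lambda>x. (b * c' + c * b') + c * c' * (x - \<alpha>) + 0 * (x - \<alpha>)^2) \<in> O[at \<alpha>](\<lambda>_. 1)"
    by (rule quad_expansion_bigo_1[OF quad_expansion_poly])
  from landau_o.big.mult[OF this landau_o.big_refl[of "\<lambda>x. (x - \<alpha>)^3"]]
  have 3: "(\<lambda>x. ((b * c' + c * b') + c * c' * (x - \<alpha>)) * (x - \<alpha>)^3) \<in> O[at \<alpha>](\<lambda>x. (x - \<alpha>)^3)"
    by simp
  have "g x * h x - (a * a' + (a * b' + b * a') * (x - \<alpha>) + (a * c' + b * b' + c * a') * (x - \<alpha>)^2)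
      = (g x - P x) * h x + P x * (h x - Q x) + ((b * c' + c * b') + c * c' * (x - \<alpha>)) * (x - \<alpha>)^3" for x
    unfolding P_def Q_def by algebra
  then show ?thesis
    unfolding quad_expansion_def using sum_in_bigo(1)[OF sum_in_bigo(1)[OF 1 2] 3] by simp
qed

lemma quad_expansion_cmult:
  assumes "quad_expansion \<alpha> g a b c"
  shows "quad_expansion \<alpha> (\<lambda>x. k * g x) (k * a) (k * b) (k * c)"
  using quad_expansion_mult[OF quad_expansion_const[of \<alpha> k] assms] by simp

lemma quad_expansion_diff:
  assumes "quad_expansion \<alpha> g a b c" "quad_expansion \<alpha> h a' b' c'"
  shows "quad_expansion \<alpha> (\<lambda>x. g x - h x) (a - a') (b - b') (c - c')"
  using quad_expansion_add[OF assms(1) quad_expansion_cmult[OF assms(2), of "-1"]] by simp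

text \<open>The coefficients of the quotient are verified rather than computed: the three equations
  say that \<open>p, q, r\<close> times the expansion of \<open>h\<close> agrees with that of
  \<open>g\<close> through degree two. The cubic discrepancy stays cubic after division, since
  \<open>1 / h\<close> is bounded near \<alpha> when \<open>a'\<close> is nonzero.\<close>

lemma quad_expansion_divide:
  assumes g: "quad_expansion \<alpha> g a b c" and h: "quad_expansion \<alpha> h a' b' c'"
    and "a' \<noteq> 0" "a = p * a'" "b = p * b' + q * a'" "c = p * c' + q * b' + r * a'"
  shows "quad_expansion \<alpha> (\<lambda>x. g x / h x) p q r"
proof -
  define P where "P = (\<lambda>x. p + q * (x - \<alpha>) + r * (x - \<alpha>)^2)"
  have "quad_expansion \<alpha> (\<lambda>x. g x - P x * h x) 0 0 0"
    using quad_expansion_diff[OF g quad_expansion_mult[OF quad_expansion_poly[of \<alpha> p q r] h]] assms(4-)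
    by (simp add: P_def)
  then have 1: "(\<lambda>x. g x - P x * h x) \<in> O[at \<alpha>](\<lambda>x. (x - \<alpha>)^3)"
    by (simp add: quad_expansion_def)
  have "(\<lambda>x. inverse (h x)) \<in> O[at \<alpha>](\<lambda>_. 1)"
    by (rule tendsto_imp_bigo_1[OF tendsto_inverse[OF quad_expansion_tendsto[OF h] \<open>a' \<noteq> 0\<close>]])
  from landau_o.big.mult[OF 1 this]
  have "(\<lambda>x. (g x - P x * h x) * inverse (h x)) \<in> O[at \<alpha>](\<lambda>x. (x - \<alpha>)^3)" by simp
  moreover have "\<forall>\<^sub>F x in at \<alpha>. (g x - P x * h x) * inverse (h x) = g x / h x - P x"
    using quad_expansion_eventually_nonzero[OF h \<open>a' \<noteq> 0\<close>]
    by eventually_elim (simp add: field_simps)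
  ultimately show ?thesis
    unfolding quad_expansion_def P_def using landau_o.big.in_cong by fastforce
qed

text \<open>Binomial expansion of a power with leading coefficient 1, where
  \<open>n (n - 1) / 2\<close> counts the pairs of linear terms.\<close>

lemma quad_expansion_power:
  assumes "quad_expansion \<alpha> g 1 b c"
  shows "quad_expansion \<alpha> (\<lambda>x. g x ^ n) 1 (n * b) (n * c + n * (real n - 1) / 2 * b^2)"
proof (induction n)
  case 0
  show ?case by (simp add: quad_expansion_const)
next
  case (Suc n)
  have "1 * (n * c + n * (real n - 1) / 2 * b^2) + b * (n * b) + c * 1
      = Suc n * c + Suc n * (real (Suc n) - 1) / 2 * b^2"
    and "1 * (n * b) + b * 1 = Suc n * b"
    by (simp_all add: field_simps power2_eq_square)
  with quad_expansion_mult[OF assms Suc] show ?case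
    by (simp only: power_Suc mult_1)
qed

text \<open>The inner point is written as \<alpha> plus \<open>x - \<alpha>\<close> times
  \<open>v x\<close>, the form of a Newton point. A nonzero limit \<open>p\<close> of
  \<open>v\<close> keeps it away from \<alpha>, where the expansion of \<open>g\<close> says
  nothing. The coefficient \<open>r\<close> of \<open>v\<close> only contributes at third
  order.\<close>

lemma quad_expansion_compose:
  assumes g: "quad_expansion \<alpha> g a b c" and v: "quad_expansion \<alpha> v p q r" "p \<noteq> 0"
  shows "quad_expansion \<alpha> (\<lambda>x. g (\<alpha> + (x - \<alpha>) * v x)) a (b * p) (b * q + c * p^2)"
proof -
  define y where "y = (\<lambda>x. \<alpha> + (x - \<alpha>) * v x)"
  have id: "quad_expansion \<alpha> (\<lambda>x. x - \<alpha>) 0 1 0"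
    using quad_expansion_poly[of \<alpha> 0 1 0] by simp
  have ya: "quad_expansion \<alpha> (\<lambda>x. y x - \<alpha>) 0 p q"
    using quad_expansion_mult[OF id v(1)] by (simp add: y_def)
  have "(y \<longlongrightarrow> \<alpha>) (at \<alpha>)"
    using quad_expansion_tendsto[OF ya] by (simp add: LIM_zero_iff)
  moreover have "\<forall>\<^sub>F x in at \<alpha>. y x \<noteq> \<alpha>"
    using quad_expansion_eventually_nonzero[OF v] eventually_neq_at_within[of \<alpha> \<alpha> UNIV]
    by eventually_elim (simp add: y_def)
  ultimately have "filterlim y (at \<alpha>) (at \<alpha>)"
    by (simp add: filterlim_at)
  from landau_o.big.compose[OF g[unfolded quad_expansion_def] this]
  have "(\<lambda>x. g (y x) - (a + b * (y x - \<alpha>) + c * (y x - \<alpha>)^2)) \<in> O[at \<alpha>](\<lambda>x. (y x - \<alpha>)^3)" .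
  also have "(\<lambda>x. (y x - \<alpha>)^3) \<in> O[at \<alpha>](\<lambda>x. (x - \<alpha>)^3)"
  proof (rule landau_o.big_power)
    show "(\<lambda>x. y x - \<alpha>) \<in> O[at \<alpha>](\<lambda>x. x - \<alpha>)"
      using landau_o.big.mult[OF landau_o.big_refl[of "\<lambda>x. x - \<alpha>"] quad_expansion_bigo_1[OF v(1)]]
      by (simp add: y_def)
  qed
  finally have 1: "quad_expansion \<alpha> (\<lambda>x. g (y x) - (a + b * (y x - \<alpha>) + c * (y x - \<alpha>)^2)) 0 0 0"
    by (simp add: quad_expansion_def)
  have 2: "quad_expansion \<alpha> (\<lambda>x. (y x - \<alpha>)^2) 0 0 (p^2)"
    using quad_expansion_mult[OF ya ya] by (simp add: power2_eq_square)
  have "quad_expansion \<alpha> (\<lambda>x. a + b * (y x - \<alpha>) + c * (y x - \<alpha>)^2) a (b * p) (b * q + c * p^2)"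
    using quad_expansion_add[OF quad_expansion_add[OF quad_expansion_const[of \<alpha> a]
      quad_expansion_cmult[OF ya, of b]] quad_expansion_cmult[OF 2, of c]] by simp
  from quad_expansion_add[OF 1 this] show ?thesis
    by (simp add: y_def)
qed

section \<open>Taylor expansion at a multiple zero\<close>

text \<open>Lagrange's remainder, with the \<open>n\<close>-th derivative bounded on a compact ball
  around \<alpha> by continuity.\<close>

lemma Taylor_bigo:
  assumes "C_class_on n D g" "open D" "\<alpha> \<in> D" "0 < n"
  shows "(\<lambda>x. g x - (\<Sum>j<n. (deriv ^^ j) g \<alpha> / fact j * (x - \<alpha>)^j)) \<in> O[at \<alpha>](\<lambda>x. (x - \<alpha>)^n)"
proof -
  obtain d where d: "d > 0" "cball \<alpha> d \<subseteq> D"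
    using assms open_contains_cball by blast
  have "continuous_on (cball \<alpha> d) ((deriv ^^ n) g)"
    using assms(1) d(2) continuous_on_subset by (auto simp: C_class_on_def)
  then have "bounded ((deriv ^^ n) g ` cball \<alpha> d)"
    by (intro compact_imp_bounded compact_continuous_image) auto
  then obtain M where M: "\<And>t. t \<in> cball \<alpha> d \<Longrightarrow> \<bar>(deriv ^^ n) g t\<bar> \<le> M"
    unfolding bounded_iff by (metis imageI real_norm_def)
  have diff: "((deriv ^^ j) g has_real_derivative (deriv ^^ Suc j) g t) (at t)"
    if "j < n" "t \<in> cball \<alpha> d" for j t
    using assms(1) that d(2) by (auto simp: C_class_on_def field_differentiable_derivI)
  have bound: "norm (g x - (\<Sum>j<n. (deriv ^^ j) g \<alpha> / fact j * (x - \<alpha>)^j)) \<le> (M / fact n) * norm ((x - \<alpha>)^n)"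
    if x: "x \<in> cball \<alpha> d" "x \<noteq> \<alpha>" for x
  proof -
    have "\<exists>t. (if x < \<alpha> then x < t \<and> t < \<alpha> else \<alpha> < t \<and> t < x) \<and>
      g x = (\<Sum>j<n. (deriv ^^ j) g \<alpha> / fact j * (x - \<alpha>)^j) + (deriv ^^ n) g t / fact n * (x - \<alpha>)^n"
      by (rule Taylor[where a = "\<alpha> - d" and b = "\<alpha> + d" and diff = "\<lambda>j. (deriv ^^ j) g"])
        (use x d(1) assms(4) diff in \<open>auto simp: dist_real_def simp del: funpow.simps\<close>)
    then obtain t where t: "if x < \<alpha> then x < t \<and> t < \<alpha> else \<alpha> < t \<and> t < x"
      and eq: "g x = (\<Sum>j<n. (deriv ^^ j) g \<alpha> / fact j * (x - \<alpha>)^j) + (deriv ^^ n) g t / fact n * (x - \<alpha>)^n"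
      by blast
    have "t \<in> cball \<alpha> d"
      using t x by (auto simp: dist_real_def split: if_splits)
    then have "\<bar>(deriv ^^ n) g t\<bar> / fact n * \<bar>x - \<alpha>\<bar> ^ n \<le> M / fact n * \<bar>x - \<alpha>\<bar> ^ n"
      by (intro mult_right_mono divide_right_mono M) auto
    then show ?thesis
      by (simp add: eq abs_mult power_abs)
  qed
  have "\<forall>\<^sub>F x in at \<alpha>. x \<in> cball \<alpha> d \<and> x \<noteq> \<alpha>"
    using d(1) eventually_at_ball'[of d \<alpha> UNIV] by (auto elim!: eventually_mono)
  then show ?thesis
    by (intro bigoI[where c = "M / fact n"]) (rule eventually_mono, assumption, rule bound, auto)
qed

text \<open>The first \<open>m\<close> Taylor terms vanish, so dividing the expansion with remainder
  of order \<open>m + 3\<close> by \<open>(x - \<alpha>)^m\<close> leaves three terms and a cubic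
  remainder.\<close>

lemma quad_expansion_at_zero:
  assumes "C_class_on (m + 3) D g" "open D" "\<alpha> \<in> D" and zero: "\<And>j. j < m \<Longrightarrow> (deriv ^^ j) g \<alpha> = 0"
  shows "quad_expansion \<alpha> (\<lambda>x. g x / (x - \<alpha>)^m) ((deriv ^^ m) g \<alpha> / fact m)
    ((deriv ^^ (m + 1)) g \<alpha> / fact (m + 1)) ((deriv ^^ (m + 2)) g \<alpha> / fact (m + 2))"
proof -
  define a b c where "a = (deriv ^^ m) g \<alpha> / fact m"
    and "b = (deriv ^^ (m + 1)) g \<alpha> / fact (m + 1)" and "c = (deriv ^^ (m + 2)) g \<alpha> / fact (m + 2)"
  have "(\<Sum>j<m+3. (deriv ^^ j) g \<alpha> / fact j * (x - \<alpha>)^j)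
      = a * (x - \<alpha>)^m + b * (x - \<alpha>)^(m + 1) + c * (x - \<alpha>)^(m + 2)" for x
  proof -
    have "{..<m+3} = {..<m} \<union> {m, m+1, m+2}" by auto
    then show ?thesis
      by (simp add: sum.union_disjoint zero a_def b_def c_def del: funpow.simps fact_Suc)
  qed
  then have "(\<lambda>x. g x - (a * (x - \<alpha>)^m + b * (x - \<alpha>)^(m + 1) + c * (x - \<alpha>)^(m + 2)))
      \<in> O[at \<alpha>](\<lambda>x. (x - \<alpha>)^(m + 3))"
    using Taylor_bigo[OF assms(1-3)] by simp
  from landau_o.big.mult[OF this landau_o.big_refl[of "\<lambda>x. inverse ((x - \<alpha>)^m)"]]
  have *: "(\<lambda>x. (g x - (a * (x - \<alpha>)^m + b * (x - \<alpha>)^(m + 1) + c * (x - \<alpha>)^(m + 2))) * inverse ((x - \<alpha>)^m))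
      \<in> O[at \<alpha>](\<lambda>x. (x - \<alpha>)^(m + 3) * inverse ((x - \<alpha>)^m))" .
  have ne: "\<forall>\<^sub>F x in at \<alpha>. x \<noteq> \<alpha>"
    by (rule eventually_neq_at_within)
  have "(\<lambda>x. g x / (x - \<alpha>)^m - (a + b * (x - \<alpha>) + c * (x - \<alpha>)^2)) \<in> O[at \<alpha>](\<lambda>x. (x - \<alpha>)^3)"
  proof (rule iffD1[OF landau_o.big.in_cong])
    show "\<forall>\<^sub>F x in at \<alpha>. (g x - (a * (x - \<alpha>)^m + b * (x - \<alpha>)^(m + 1) + c * (x - \<alpha>)^(m + 2))) * inverse ((x - \<alpha>)^m)
       = g x / (x - \<alpha>)^m - (a + b * (x - \<alpha>) + c * (x - \<alpha>)^2)"
      using ne by eventually_elim (simp add: field_simps power_add power2_eq_square)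
    have "\<forall>\<^sub>F x in at \<alpha>. (x - \<alpha>)^(m + 3) * inverse ((x - \<alpha>)^m) = (x - \<alpha>)^3"
      using ne by eventually_elim (simp add: field_simps power_add)
    with * show "(\<lambda>x. (g x - (a * (x - \<alpha>)^m + b * (x - \<alpha>)^(m + 1) + c * (x - \<alpha>)^(m + 2))) * inverse ((x - \<alpha>)^m))
      \<in> O[at \<alpha>](\<lambda>x. (x - \<alpha>)^3)"
      by (simp cong: landau_o.big.cong)
  qed
  then show ?thesis
    by (simp add: quad_expansion_def a_def b_def c_def)
qed


section \<open>The error equation for one step of the method\<close>

lemma C_class_on_deriv:
  assumes "C_class_on (Suc k) D f"
  shows "C_class_on k D (deriv f)"
  using assms by (auto simp: C_class_on_def funpow_swap1 dest: spec[of _ "Suc _"])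

lemma order_three_at_multiple_zero:
  fixes f :: "real \<Rightarrow> real" and \<alpha> :: real and m :: nat
  assumes m: "2 \<le> m" and D: "open D" "\<alpha> \<in> D" and f: "C_class_on (m + 3) D f"
    and zero: "zero_of_multiplicity f \<alpha> m"
  defines "c \<equiv> (deriv ^^ m) f \<alpha> / fact m"
  defines "A \<equiv> (deriv ^^ (m + 1)) f \<alpha> / fact (m + 1) / c"
  defines "B \<equiv> (deriv ^^ (m + 2)) f \<alpha> / fact (m + 2) / c"
  shows "order_three_at D (((real m - 1) / real m) ^ (m - 1)) f \<alpha>
    (A^2 / (2 * m) - (real m - 1) * B / m^2)"
proof -
  define r where "r = (real m - 1) / real m"
  define \<theta> where "\<theta> = r ^ (m - 1)"
  define C where "C = A^2 / (2 * m) - (real m - 1) * B / m^2"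
  define F where "F = (\<lambda>x. f x / (x - \<alpha>)^m / c)"
  define G where "G = (\<lambda>x. deriv f x / (x - \<alpha>)^(m - 1) / c)"
  have c: "c \<noteq> 0"
    using zero by (simp add: c_def zero_of_multiplicity_def)
  have r: "r \<noteq> 0" and \<theta>: "\<theta> \<noteq> 0" and m0: "real m \<noteq> 0" "real m - 1 \<noteq> 0"
    using m by (auto simp: r_def \<theta>_def)
  \<comment> \<open>The choice of \<theta> enters here: it makes \<theta> a common factor of
    \<open>\<theta> * f x\<close> and the value of \<open>f\<close> at the Newton point.\<close>
  have rm: "r ^ m = \<theta> * r"
    using m by (simp add: \<theta>_def flip: power_Suc2)
  have F: "quad_expansion \<alpha> F 1 A B"
  proof -
    have "quad_expansion \<alpha> (\<lambda>x. f x / (x - \<alpha>)^m) c (c * A) (c * B)"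
      using quad_expansion_at_zero[OF f D] zero c
      by (simp add: zero_of_multiplicity_def c_def A_def B_def del: funpow.simps fact_Suc)
    from quad_expansion_cmult[OF this, of "1 / c"] show ?thesis
      using c by (simp add: F_def mult.commute)
  qed
  have G: "quad_expansion \<alpha> G m ((real m + 1) * A) ((real m + 2) * B)"
  proof -
    \<comment> \<open>Differentiation multiplies the Taylor coefficient of degree
      \<open>j + 1\<close> by \<open>j + 1\<close>. This expresses the coefficients of
      \<open>deriv f\<close> through those of \<open>f\<close>, that is, through \<open>c\<close>,
      \<open>A\<close> and \<open>B\<close>.\<close>
    have fact_shift: "z / fact j = real (Suc j) * (z / fact (Suc j))" for z :: real and j
      by (simp del: of_nat_Suc)
    obtain n where n: "m = Suc n" using m by (cases m) auto
    have "C_class_on (n + 3) D (deriv f)"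
      using f by (intro C_class_on_deriv) (simp add: n)
    moreover have "(deriv ^^ j) (deriv f) \<alpha> = 0" if "j < n" for j
      using zero that by (auto simp: zero_of_multiplicity_def n funpow_swap1 dest: spec[of _ "Suc j"])
    ultimately
    have "quad_expansion \<alpha> (\<lambda>x. deriv f x / (x - \<alpha>)^n) ((deriv ^^ Suc n) f \<alpha> / fact n)
      ((deriv ^^ Suc (n + 1)) f \<alpha> / fact (n + 1)) ((deriv ^^ Suc (n + 2)) f \<alpha> / fact (n + 2))"
      using quad_expansion_at_zero[of n D "deriv f" \<alpha>] D
      by (simp add: funpow_Suc_right del: funpow.simps fact_Suc)
    also have "(deriv ^^ Suc n) f \<alpha> / fact n = c * m"
      by (subst fact_shift) (simp add: c_def n del: funpow.simps fact_Suc)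
    also have "(deriv ^^ Suc (n + 1)) f \<alpha> / fact (n + 1) = c * ((real m + 1) * A)"
      using c by (subst fact_shift) (simp add: A_def n del: funpow.simps fact_Suc)
    also have "(deriv ^^ Suc (n + 2)) f \<alpha> / fact (n + 2) = c * ((real m + 2) * B)"
      using c by (subst fact_shift) (simp add: B_def n del: funpow.simps fact_Suc)
    finally have "quad_expansion \<alpha> (\<lambda>x. deriv f x / (x - \<alpha>)^n) (c * m) (c * ((real m + 1) * A))
      (c * ((real m + 2) * B))" .
    from quad_expansion_cmult[OF this, of "1 / c"] show ?thesis
      using c by (simp add: G_def n mult.commute)
  qed
  \<comment> \<open>The quadratic coefficient of \<open>m F / G\<close>, found by comparing
    coefficients in \<open>F = U G\<close>.\<close>
  define k where "k = ((real m + 1) * A^2 / m - 2 * B) / m"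
  define U where "U = (\<lambda>x. F x / G x)"
  have U: "quad_expansion \<alpha> U (1 / m) (- A / m^2) (k / m)"
    unfolding U_def
    by (rule quad_expansion_divide[OF F G])
      (use m0 in \<open>auto simp: k_def field_simps power2_eq_square\<close>)
  \<comment> \<open>The Newton error divided by \<open>x - \<alpha>\<close>.\<close>
  define v where "v = (\<lambda>x. 1 - U x)"
  have v: "quad_expansion \<alpha> v r (A / m^2) (- k / m)"
    using quad_expansion_diff[OF quad_expansion_const[of \<alpha> 1] U] m0
    by (simp add: v_def r_def diff_divide_distrib)
  \<comment> \<open>Normalised to leading coefficient 1, as the power rule requires; the factor
    \<open>r ^ m\<close> split off is \<open>\<theta> * r\<close>.\<close>
  define w where "w = (\<lambda>x. v x / r)"
  have w: "quad_expansion \<alpha> w 1 (A / (m * (real m - 1))) (- k / (real m - 1))"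
    unfolding w_def
    by (rule quad_expansion_divide[OF v quad_expansion_const])
      (use r m0 in \<open>auto simp: r_def field_simps power2_eq_square\<close>)
  define y where "y = (\<lambda>x. \<alpha> + (x - \<alpha>) * v x)"
  have Fy: "quad_expansion \<alpha> (\<lambda>x. F (y x)) 1 (A * r) (A * (A / m^2) + B * r^2)"
    unfolding y_def by (rule quad_expansion_compose[OF F v r])
  \<comment> \<open>The denominator \<open>\<theta> * f x - f (y x)\<close> divided by
    \<open>c * \<theta> * (x - \<alpha>)^m\<close>. Its limit is
    \<open>1 - r = 1 / m\<close>.\<close>
  define T where "T = (\<lambda>x. F x - r * (F (y x) * w x ^ m))"
  note T' = quad_expansion_diff[OF F quad_expansion_cmult[OF quad_expansion_mult[OF Fy
    quad_expansion_power[OF w, of m]], of r], folded T_def]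
  have T1: "1 - r * (1 * 1) \<noteq> 0"
    using m0 by (simp add: r_def field_simps)
  have ratio: "quad_expansion \<alpha> (\<lambda>x. F x * U x / T x) 1 0 (- C)"
  proof (rule quad_expansion_divide[OF quad_expansion_mult[OF F U] T' T1])
    \<comment> \<open>In terms of \<open>s\<close> the denominators become powers of
      \<open>s\<close> and \<open>s + 1\<close>, and clearing them leaves polynomial
      identities.\<close>
    define s where "s = real m - 1"
    have ms: "real m = s + 1" "s \<noteq> 0" "s + 1 \<noteq> 0" using m by (auto simp: s_def)
    show "1 * (1 / real m) = 1 * (1 - r * (1 * 1))"
      using m0 by (simp add: r_def field_simps)
    \<comment> \<open>Both linear coefficients equal \<open>(m - 1) A / m^2\<close>. This
      cancellation removes the quadratic term of the error equation.\<close>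
    show "1 * (- A / m^2) + A * (1 / m) =
      1 * (A - r * (1 * (m * (A / (m * (real m - 1)))) + A * r * 1)) + 0 * (1 - r * (1 * 1))"
      unfolding r_def of_nat_power ms(1) using ms(2,3) by (simp add: divide_simps) algebra
    \<comment> \<open>Comparison in degree two is what determines \<open>C\<close>.\<close>
    show "1 * (k / m) + A * (- A / m^2) + B * (1 / m) =
      1 * (B - r * (1 * (m * (- k / (real m - 1)) + m * (real m - 1) / 2 * (A / (m * (real m - 1)))^2) +
           A * r * (m * (A / (m * (real m - 1)))) + (A * (A / m^2) + B * r^2) * 1)) +
      0 * (A - r * (1 * (m * (A / (m * (real m - 1)))) + A * r * 1)) + (- C) * (1 - r * (1 * 1))"
      unfolding r_def k_def C_def of_nat_power of_nat_mult of_nat_numeral ms(1)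
      using ms(2,3) by (simp add: divide_simps) algebra
  qed
  have err: "quad_expansion \<alpha> (\<lambda>x. 1 - F x * U x / T x) 0 0 C"
    using quad_expansion_diff[OF quad_expansion_const[of \<alpha> 1] ratio] by simp
  have ev: "\<forall>\<^sub>F x in at \<alpha>. x \<noteq> \<alpha> \<and> G x \<noteq> 0 \<and> v x \<noteq> 0 \<and> T x \<noteq> 0"
    using quad_expansion_eventually_nonzero[OF G m0(1)] quad_expansion_eventually_nonzero[OF v r]
      quad_expansion_eventually_nonzero[OF T' T1] eventually_neq_at_within[of \<alpha> \<alpha> UNIV]
    by eventually_elim simp
  \<comment> \<open>Where none of the factors vanishes, the formulas for the iteration hold exactly;
    asymptotics enter only through \<open>err\<close>.\<close>
  have step: "deriv f x \<noteq> 0 \<and> newton_point f x = y x \<and> \<theta> * f x - f (y x) \<noteq> 0 \<and>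
      next_iterate \<theta> f x - \<alpha> = (x - \<alpha>) * (1 - F x * U x / T x)"
    if x: "x \<noteq> \<alpha> \<and> G x \<noteq> 0 \<and> v x \<noteq> 0 \<and> T x \<noteq> 0" for x
  proof -
    define e where "e = x - \<alpha>"
    have e: "e \<noteq> 0" using x by (simp add: e_def)
    have fx: "f x = c * e^m * F x"
      using c e by (simp add: F_def e_def)
    have f'x: "deriv f x = c * e^(m - 1) * G x"
      using c e by (simp add: G_def e_def)
    have em: "e^m = e^(m - 1) * e"
      using m by (simp flip: power_Suc2)
    have quot: "f x / deriv f x = e * U x"
      unfolding fx f'x em U_def using c e x by (simp add: field_simps)
    have newton: "newton_point f x = y x"
      by (simp add: newton_point_def quot y_def v_def e_def algebra_simps)
    \<comment> \<open>Since \<open>r * w x = v x\<close> is nonzero, \<open>y x\<close> differs from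
      \<alpha>, and the division in \<open>F (y x)\<close> can be undone.\<close>
    have yv: "y x - \<alpha> = e * (r * w x)" "r * w x \<noteq> 0"
      using r x by (simp_all add: y_def w_def e_def)
    have fy: "f (y x) = c * (e * (r * w x))^m * F (y x)"
      using c e yv(2) by (simp add: F_def yv(1))
    have den: "\<theta> * f x - f (y x) = c * e^m * \<theta> * T x"
      by (simp add: fx fy T_def power_mult_distrib rm algebra_simps)
    have "\<theta> * f x / (\<theta> * f x - f (y x)) = F x / T x"
      unfolding den unfolding fx using c e x \<theta> by (simp add: field_simps)
    then have "next_iterate \<theta> f x - \<alpha> = e * (1 - F x * U x / T x)"
      by (simp add: next_iterate_def newton quot) (simp add: e_def algebra_simps)
    with newton den f'x show ?thesis
      using c e x \<theta> by (simp add: e_def)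
  qed
  have at: "at \<alpha> within D = at \<alpha>"
    using D by (rule at_within_open[rotated])
  have "(y \<longlongrightarrow> \<alpha> + (\<alpha> - \<alpha>) * r) (at \<alpha>)"
    unfolding y_def by (intro tendsto_intros quad_expansion_tendsto[OF v])
  then have yD: "\<forall>\<^sub>F x in at \<alpha>. y x \<in> D"
    using D by (auto intro: topological_tendstoD)
  have "\<forall>\<^sub>F x in at \<alpha>. next_iterate_defined D \<theta> f x"
    using ev yD by eventually_elim (use step in \<open>auto simp: next_iterate_defined_def\<close>)
  moreover have "(\<lambda>x. (next_iterate \<theta> f x - \<alpha>) - C * (x - \<alpha>)^3) \<in> O[at \<alpha>](\<lambda>x. (x - \<alpha>)^4)"
  proof (rule iffD1[OF landau_o.big.in_cong])
    \<comment> \<open>Multiplying \<open>err\<close> by \<open>x - \<alpha>\<close> raises the cubic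
      remainder to fourth order and turns its quadratic term into
      \<open>C (x - \<alpha>)^3\<close>.\<close>
    show "(\<lambda>x. (x - \<alpha>) * ((1 - F x * U x / T x) - (0 + 0 * (x - \<alpha>) + C * (x - \<alpha>)^2)))
        \<in> O[at \<alpha>](\<lambda>x. (x - \<alpha>)^4)"
      using landau_o.big.mult[OF landau_o.big_refl[of "\<lambda>x. x - \<alpha>"] err[unfolded quad_expansion_def]]
      by (simp flip: power_Suc)
    show "\<forall>\<^sub>F x in at \<alpha>. (x - \<alpha>) * ((1 - F x * U x / T x) - (0 + 0 * (x - \<alpha>) + C * (x - \<alpha>)^2))
        = (next_iterate \<theta> f x - \<alpha>) - C * (x - \<alpha>)^3"
      using ev
    proof eventually_elim
      case (elim x)
      then show ?case
        using step[of x] by (simp add: algebra_simps power2_eq_square power3_eq_cube)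
    qed
  qed
  ultimately show ?thesis
    by (simp add: order_three_at_def at \<theta>_def r_def C_def)
qed

theorem theorem1:
  shows "\<exists>C :: nat \<Rightarrow> real list \<Rightarrow> real.
    \<forall>(m::nat) (D::real set) (f::real \<Rightarrow> real) (\<alpha>::real).
      2 \<le> m \<and> open D \<and> is_interval D \<and> C_class_on (m + 3) D f \<and>
      \<alpha> \<in> D \<and> zero_of_multiplicity f \<alpha> m \<longrightarrow>
      order_three_at D (((real m - 1) / real m) ^ (m - 1)) f \<alpha>
        (C m (map (\<lambda>j. (deriv ^^ j) f \<alpha>) [0..<m + 4]))"
proof (intro exI allI impI)
  fix m :: nat and D :: "real set" and f :: "real \<Rightarrow> real" and \<alpha> :: real
  \<comment> \<open>With \<open>l\<close> the list of derivatives of \<open>f\<close> at \<alpha>,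
    starting with order 0, \<open>?c m l\<close> is the Taylor coefficient of degree
    \<open>m\<close>. Thus \<open>?C\<close> rebuilds the constant from \<open>m\<close> and the
    entries \<open>m\<close>, \<open>m + 1\<close>, \<open>m + 2\<close> of the list, independently
    of \<open>D\<close> and of \<open>f\<close> away from \<alpha>.\<close>
  let ?c = "\<lambda>m l. l ! m / fact m :: real"
  let ?C = "\<lambda>m l. (?c (m + 1) l / ?c m l)^2 / (2 * m) - (real m - 1) * (?c (m + 2) l / ?c m l) / m^2"
  assume "2 \<le> m \<and> open D \<and> is_interval D \<and> C_class_on (m + 3) D f \<and>
    \<alpha> \<in> D \<and> zero_of_multiplicity f \<alpha> m"
  then show "order_three_at D (((real m - 1) / real m) ^ (m - 1)) f \<alpha>
      (?C m (map (\<lambda>j. (deriv ^^ j) f \<alpha>) [0..<m + 4]))"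
    using order_three_at_multiple_zero[of m D \<alpha> f]
    by (simp add: nth_append del: funpow.simps fact_Suc upt_Suc)
qed

end
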